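(* Let $\delta>0$ be fixed. For each integer $n\ge2$ the following asymptotic expansion holds: $$\begin{aligned}\zeta_E'(-n,q)\sim{}&\frac14 q^{n-1}-\frac12E_n(q)\log q-\frac12\sum_{k=1}^{\lfloor n/2\rfloor}E_{2k+1}(0)\sum_{j=0}^{2k}\binom nj\frac{(-1)^j}{2k-j+1}\,q^{n-2k-1}\\&+(-1)^{n+1}\frac{n!}{2}\sum_{k=\lfloor n/2\rfloor+1}^\infty\frac{E_{2k+1}(0)}{(2k+1)(2k)\cdots(2k-n+1)}\,q^{n-2k-1}\end{aligned}$$ as $|q|\to\infty$ in the sector $|\arg q|\le\pi-\delta$.
   Context: For $|\arg q|<\pi$, $\zeta_E(s,q)$ denotes the alternating Hurwitz zeta function, defined for $\mathrm{Re}(s)>0$ by $\zeta_E(s,q)=\sum_{n=0}^\infty \frac{(-1)^n}{(n+q)^s}$ (principal branches) and extended to an entire function of $s\in\mathbb C$ by analytic continuation; $\zeta_E'(-n,q)=\frac{\partial}{\partial s}\zeta_E(s,q)\big|_{s=-n}$. $E_n(x)$ are the Euler polynomials, $\frac{2e^{xt}}{e^t+1}=\sum_{n\ge0}E_n(x)\frac{t^n}{n!}$ for $|t|<\pi$. $\log q$ is the principal value. The product $(2k+1)(2k)\cdots(2k-n+1)$ has the $n+1$ consecutive integer factors from $2k+1$ down to $2k-n+1$ inclusive. The symbol $\sim$ means asymptotic expansion in the Poincaré sense: for each integer $K\ge\lfloor n/2\rfloor$, the difference between the left side and the right side with the infinite series in $k$ truncated after $k=K$ is $O(|q|^{n-2K-3})$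 as $|q|\to\infty$ in the sector, the implied constant depending only on $n,\delta,K$. *)

theory Defs
  imports "HOL-Complex_Analysis.Complex_Analysis" "HOL-Library.Landau_Symbols"
begin

text \<open>
  The alternating Hurwitz zeta function, intended for \<open>\<bar>arg q\<bar> < \<pi>\<close>. For such \<open>q\<close> the series
  converges (in general only conditionally) for \<open>Re s > 0\<close>, and its sum has exactly one entire
  continuation. \<^const>\<open>powr\<close> is the principal branch.
\<close>

definition alt_hurwitz_zeta :: "complex \<Rightarrow> complex \<Rightarrow> complex" where
  "alt_hurwitz_zeta s q =
     (THE f. f holomorphic_on UNIV \<and>
        (\<forall>z. Re z > 0 \<longrightarrow> (\<lambda>n. (-1) ^ n / (of_nat n + q) powr z) sums f z)) s"

text \<open>
  The value \<open>E\<^sub>n(x)\<close> of the Euler polynomial, read off the exponential generating function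
  \<open>2 e\<^bsup>xt\<^esup> / (e\<^sup>t + 1)\<close>, which is taken as a formal power series in \<open>t\<close>; convergence for
  \<open>\<bar>t\<bar> < \<pi>\<close> is \<open>euler_poly_sums\<close> below.
\<close>

definition euler_poly :: "nat \<Rightarrow> complex \<Rightarrow> complex" where
  "euler_poly n x = fact n * fps_nth (2 * fps_exp x / (fps_exp 1 + 1)) n"

lemma euler_poly_sums:
  assumes "norm t < pi"
  shows "(\<lambda>n. euler_poly n x * t ^ n / fact n) sums (2 * exp (x * t) / (exp t + 1))"
proof -
  let ?f = "\<lambda>t::complex. 2 * exp (x * t) / (exp t + 1)"
  have nz: "exp z + 1 \<noteq> 0" if "norm z < pi" for z :: complex
  proof
    assume "exp z + 1 = 0"
    then have "exp z = exp (\<i> * of_real pi)"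
      by (simp add: eq_neg_iff_add_eq_0)
    moreover have "\<bar>Im z\<bar> < pi"
      using abs_Im_le_cmod[of z] that by linarith
    then have "\<bar>Im z - Im (\<i> * of_real pi)\<bar> < 2 * pi"
      unfolding Im_i_times Re_complex_of_real by linarith
    ultimately have "z = \<i> * of_real pi"
      by (metis exp_complex_eqI)
    then have "norm z = pi"
      by (simp add: norm_mult)
    with that show False by simp
  qed
  have "?f has_fps_expansion 2 * fps_exp x / (fps_exp 1 + 1)"
    by (rule has_fps_expansion_divide' has_fps_expansion_mult has_fps_expansion_add
          has_fps_expansion_numeral has_fps_expansion_1 has_fps_expansion_exp
          has_fps_expansion_exp1)+ simp
  then have coeff: "euler_poly n x = (deriv ^^ n) ?f 0" for n
    by (simp add: euler_poly_def fps_nth_fps_expansion)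
  have "?f holomorphic_on ball 0 pi"
    using nz by (intro holomorphic_intros) auto
  from holomorphic_power_series[OF this, of t] assms show ?thesis
    by (simp add: coeff)
qed

end

theory Submission
  imports Defs
begin

text \<open>
  Let \<open>D\<close> be differentiation in \<open>x\<close>. Since \<open>2 / (e\<^sup>t + 1)\<close> generates the numbers \<open>E\<^sub>k(0) / k!\<close>, the
  truncation \<open>G\<close> of \<open>(1 + e\<^sup>D)\<^sup>-\<^sup>1 x\<^sup>-\<^sup>s\<close> after \<open>D\<^sup>M\<close> nearly solves \<open>G(x) + G(x + 1) = x\<^sup>-\<^sup>s\<close>: by Taylor's
  theorem the defect \<open>R(s, x)\<close> is \<open>O(\<bar>x\<bar>\<close> to the power \<open>- Re s - M - 1)\<close> in the sector. Telescoping the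
  alternating series gives \<open>\<zeta>\<^sub>E(s, q) = G(q) + \<Sum>j. (-1)\<^sup>j R(s, q + j)\<close>, whose right-hand side converges on
  a disc of radius about \<open>M\<close> and therefore provides the continuation there. Cauchy's inequality
  transfers the bound on the defect series to its \<open>s\<close>-derivative at \<open>-n\<close>, and the derivative of \<open>G\<close>
  is explicit: up to a factor, the coefficient of \<open>q\<close> to the power \<open>-s - m\<close> is \<open>-s gchoose m\<close>.
\<close>

subsection \<open>Values of the Euler polynomials at zero\<close>

definition euler_coeff :: "nat \<Rightarrow> complex" where
  "euler_coeff k = fps_nth (2 / (fps_exp 1 + 1)) k"

lemma euler_poly_0: "euler_poly k 0 = fact k * euler_coeff k"
  by (simp add: euler_poly_def euler_coeff_def)

lemma euler_fps_mult: "(2 / (fps_exp 1 + 1)) * (fps_exp 1 + 1) = (2 :: complex fps)"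
proof -
  have "fps_nth (fps_exp 1 + 1 :: complex fps) 0 \<noteq> 0"
    by simp
  then show ?thesis
    by (simp add: fps_divide_unit mult.assoc inverse_mult_eq_1)
qed

text \<open>Multiplying the series \<open>2 / (fps_exp 1 + 1)\<close> by \<open>fps_exp x\<close>
  gives a convolution. The upper limit may be any \<open>M \<ge> n\<close> since the extra binomials
  vanish; this matches the index range of \<open>boole_sum\<close>.\<close>

lemma euler_poly_binomial_sum:
  assumes "n \<le> M"
  shows "euler_poly n x = (\<Sum>k\<le>M. of_nat (n choose k) * euler_poly k 0 * x ^ (n - k))"
proof -
  have "2 * fps_exp x / (fps_exp 1 + 1) = 2 / (fps_exp 1 + 1) * (fps_exp x :: complex fps)"
    by (simp add: fps_divide_unit mult_ac)
  then have "euler_poly n x = fact n * (\<Sum>k\<le>n. euler_coeff k * (x ^ (n - k) / fact (n - k)))"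
    by (simp add: euler_poly_def euler_coeff_def fps_mult_nth atLeast0AtMost)
  also have "\<dots> = (\<Sum>k\<le>n. of_nat (n choose k) * euler_poly k 0 * x ^ (n - k))"
    unfolding sum_distrib_left by (intro sum.cong) (auto simp: euler_poly_0 binomial_fact)
  also have "\<dots> = (\<Sum>k\<le>M. of_nat (n choose k) * euler_poly k 0 * x ^ (n - k))"
    using assms by (intro sum.mono_neutral_left) auto
  finally show ?thesis .
qed

text \<open>Coefficient comparison in A e^t = 2 - A, where A = 2 / (e^t + 1). It makes the Taylor
  polynomials in \<open>norm_boole_defect_le\<close> collapse.\<close>

lemma euler_coeff_recurrence:
  "(\<Sum>k\<le>m. euler_coeff k / fact (m - k)) = (if m = 0 then 2 else 0) - euler_coeff m"
proof -
  let ?A = "2 / (fps_exp 1 + 1) :: complex fps"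
  have "?A * fps_exp 1 = 2 - ?A"
    using euler_fps_mult by (simp add: algebra_simps)
  then have "fps_nth (?A * fps_exp 1) m = fps_nth (2 - ?A) m"
    by simp
  then show ?thesis
    by (simp add: fps_mult_nth atLeast0AtMost euler_coeff_def fps_numeral_nth)
qed

text \<open>This holds because \<open>2 / (e\<^sup>t + 1) - 1\<close> is an odd function of \<open>t\<close>.\<close>

lemma euler_coeff_reflect: "euler_coeff k + (-1) ^ k * euler_coeff k = (if k = 0 then 2 else 0)"
proof -
  let ?A = "2 / (fps_exp 1 + 1) :: complex fps"
  \<comment> \<open>\<open>B\<close> is A(-t). Multiplying B (e^(-t) + 1) = 2 by e^t gives B (e^t +
    1) = 2 e^t, whence A + B = 2.\<close>
  define B where "B = Abs_fps (\<lambda>k. (-1) ^ k * fps_nth ?A k)"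
  have "B * (fps_exp (-1) + 1) = 2"
  proof (rule fps_ext)
    fix m
    have "fps_nth (B * (fps_exp (-1) + 1)) m = (-1) ^ m * fps_nth (?A * (fps_exp 1 + 1)) m"
      unfolding fps_mult_nth sum_distrib_left
      by (intro sum.cong refl)
         (auto simp: B_def mult_ac simp flip: power_add)
    also have "\<dots> = fps_nth 2 m"
      unfolding euler_fps_mult by (simp add: fps_numeral_nth)
    finally show "fps_nth (B * (fps_exp (-1) + 1)) m = fps_nth 2 m" .
  qed
  moreover have "(fps_exp (-1) + 1) * fps_exp 1 = fps_exp 1 + (1 :: complex fps)"
    by (simp add: algebra_simps flip: fps_exp_add_mult)
  ultimately have "B * (fps_exp 1 + 1) = 2 * fps_exp 1"
    by (metis mult.assoc)
  moreover have "?A * (fps_exp 1 + 1) = 2"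
    by (rule euler_fps_mult)
  ultimately have "(?A + B) * (fps_exp 1 + 1) = 2 * (fps_exp 1 + 1)"
    by (simp add: algebra_simps)
  moreover have "fps_exp 1 + 1 \<noteq> (0 :: complex fps)"
  proof
    assume "fps_exp 1 + 1 = (0 :: complex fps)"
    then have "fps_nth (fps_exp 1 + 1 :: complex fps) 0 = 0" by simp
    then show False by simp
  qed
  ultimately have "?A + B = 2"
    by (metis mult_cancel_right)
  then have "fps_nth (?A + B) k = fps_nth 2 k" by simp
  then show ?thesis
    by (simp add: B_def euler_coeff_def fps_numeral_nth)
qed

lemma euler_poly_0_even: "even k \<Longrightarrow> k > 0 \<Longrightarrow> euler_poly k 0 = 0"
  using euler_coeff_reflect[of k] by (simp add: euler_poly_0)

lemma euler_poly_1_0: "euler_poly 1 0 = - 1 / 2"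
  using euler_coeff_recurrence[of 1] euler_coeff_reflect[of 0]
  by (simp add: euler_poly_0 field_simps eq_neg_iff_add_eq_0)

subsection \<open>Boole summation for complex powers\<close>

text \<open>The closed form makes the dependence on \<open>s\<close> explicit: a polynomial times an
  exponential.\<close>

definition powr_deriv :: "nat \<Rightarrow> complex \<Rightarrow> complex \<Rightarrow> complex" where
  "powr_deriv m s x = (-1) ^ m * pochhammer s m * x powr (- s - of_nat m)"

lemma powr_deriv_0 [simp]: "powr_deriv 0 s x = x powr - s"
  by (simp add: powr_deriv_def)

lemma has_field_derivative_powr_deriv:
  assumes "x \<notin> \<real>\<^sub>\<le>\<^sub>0"
  shows "(powr_deriv m s has_field_derivative powr_deriv (Suc m) s x) (at x within S)"
proof -
  have "((\<lambda>x. (-1) ^ m * pochhammer s m * x powr (- s - of_nat m)) has_field_derivative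
      (-1) ^ m * pochhammer s m * ((- s - of_nat m) * x powr (- s - of_nat m - 1))) (at x within S)"
    using assms
    by (intro DERIV_cmult has_field_derivative_at_within[OF has_field_derivative_powr])
  moreover have "(-1) ^ m * pochhammer s m * ((- s - of_nat m) * x powr (- s - of_nat m - 1)) =
      powr_deriv (Suc m) s x"
    by (simp add: powr_deriv_def pochhammer_Suc algebra_simps)
  ultimately show ?thesis
    by (simp add: powr_deriv_def[abs_def])
qed

text \<open>This is G of the overview; the division by 2 compensates for \<open>euler_coeff\<close>
  generating 2 / (e^t + 1).\<close>

definition boole_sum :: "nat \<Rightarrow> complex \<Rightarrow> complex \<Rightarrow> complex" where
  "boole_sum M s x = (\<Sum>k\<le>M. euler_coeff k * powr_deriv k s x) / 2"

definition boole_defect :: "nat \<Rightarrow> complex \<Rightarrow> complex \<Rightarrow> complex" where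
  "boole_defect M s x = x powr - s - boole_sum M s x - boole_sum M s (x + 1)"

lemma sum_triangle_atMost:
  fixes g :: "nat \<Rightarrow> nat \<Rightarrow> 'a::comm_monoid_add"
  shows "(\<Sum>k\<le>M. \<Sum>i\<le>M - k. g k i) = (\<Sum>m\<le>M. \<Sum>k\<le>m. g k (m - k))"
proof -
  have "(\<Sum>k\<le>M. \<Sum>i\<le>M - k. g k i) = (\<Sum>(k, i)\<in>(SIGMA k:{..M}. {..M - k}). g k i)"
    by (simp add: sum.Sigma)
  also have "(SIGMA k:{..M}. {..M - k}) = {(k, i). k + i \<le> M}"
    by auto
  finally show ?thesis
    by (simp add: sum.triangle_reindex_eq)
qed

text \<open>Each derivative in \<open>boole_sum M s (x + 1)\<close> is expanded by Taylor at
  \<open>x\<close>. The polynomial parts cancel against the other terms of the defect, so only the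
  remainders survive.\<close>

lemma norm_boole_defect_le:
  assumes nz: "\<And>t. 0 \<le> t \<Longrightarrow> t \<le> 1 \<Longrightarrow> x + of_real t \<notin> \<real>\<^sub>\<le>\<^sub>0"
    and B: "\<And>t. 0 \<le> t \<Longrightarrow> t \<le> 1 \<Longrightarrow> norm (powr_deriv (Suc M) s (x + of_real t)) \<le> B"
  shows "norm (boole_defect M s x) \<le> (\<Sum>k\<le>M. norm (euler_coeff k)) * B"
proof -
  \<comment> \<open>The degree \<open>M - k\<close> is chosen so that every remainder involves the
    same derivative, of order \<open>Suc M\<close>, and the single bound \<open>B\<close> serves for
    all \<open>k\<close>.\<close>
  define T where "T k = (\<Sum>i\<le>M - k. powr_deriv (k + i) s x / fact i)" for k
  have T: "norm (powr_deriv k s (x + 1) - T k) \<le> B" if "k \<le> M" for k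
  proof -
    have seg: "\<exists>t. 0 \<le> t \<and> t \<le> 1 \<and> y = x + of_real t" if "y \<in> closed_segment x (x + 1)" for y
      using that by (auto simp: closed_segment_def scaleR_conv_of_real algebra_simps)
    have "norm (powr_deriv (k + 0) s (x + 1) -
        (\<Sum>i\<le>M - k. powr_deriv (k + i) s x * (x + 1 - x) ^ i / fact i))
        \<le> B * norm (x + 1 - x) ^ Suc (M - k) / fact (M - k)"
    proof (rule complex_Taylor[of "closed_segment x (x + 1)"])
      fix i y assume "y \<in> closed_segment x (x + 1)"
      with seg nz have "y \<notin> \<real>\<^sub>\<le>\<^sub>0" by blast
      then show "(powr_deriv (k + i) s has_field_derivative powr_deriv (k + Suc i) s y)
          (at y within closed_segment x (x + 1))"
        by (simp add: has_field_derivative_powr_deriv)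
    next
      fix y assume "y \<in> closed_segment x (x + 1)"
      with seg B show "norm (powr_deriv (k + Suc (M - k)) s y) \<le> B"
        using that by fastforce
    qed auto
    also have "B * norm (x + 1 - x) ^ Suc (M - k) / fact (M - k) \<le> B"
    proof -
      have "0 \<le> B"
        by (rule order_trans[OF norm_ge_zero B[of 0]]) auto
      moreover have "(1 :: real) \<le> fact (M - k)"
        by simp
      ultimately have "B * 1 \<le> B * fact (M - k)"
        by (intro mult_left_mono)
      then show ?thesis
        by (simp add: divide_le_eq)
    qed
    finally show ?thesis
      by (simp add: T_def)
  qed
  have "(\<Sum>k\<le>M. euler_coeff k * T k) =
      (\<Sum>k\<le>M. \<Sum>i\<le>M - k. euler_coeff k * powr_deriv (k + i) s x / fact i)"
    by (simp add: T_def sum_distrib_left)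
  \<comment> \<open>After regrouping by the total order m = k + i, the inner sums are those of
    \<open>euler_coeff_recurrence\<close>.\<close>
  also have "\<dots> = (\<Sum>m\<le>M. \<Sum>k\<le>m. euler_coeff k * powr_deriv (k + (m - k)) s x / fact (m - k))"
    by (rule sum_triangle_atMost)
  also have "\<dots> = (\<Sum>m\<le>M. powr_deriv m s x * (\<Sum>k\<le>m. euler_coeff k / fact (m - k)))"
    unfolding sum_distrib_left by (intro sum.cong refl) (auto simp: mult_ac)
  also have "\<dots> = (\<Sum>m\<le>M. (if m = 0 then 2 * powr_deriv m s x else 0)) -
      (\<Sum>m\<le>M. euler_coeff m * powr_deriv m s x)"
    unfolding euler_coeff_recurrence sum_subtractf[symmetric]
    by (intro sum.cong refl) (auto simp: algebra_simps)
  finally have "(\<Sum>k\<le>M. euler_coeff k * T k) = 2 * x powr - s - 2 * boole_sum M s x"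
    by (simp add: boole_sum_def)
  then have "boole_defect M s x = - (\<Sum>k\<le>M. euler_coeff k * (powr_deriv k s (x + 1) - T k)) / 2"
    unfolding boole_defect_def boole_sum_def[of M s "x + 1"] right_diff_distrib sum_subtractf
    by simp
  also have "norm \<dots> \<le> (\<Sum>k\<le>M. norm (euler_coeff k) * B) / 2"
    using T by (auto simp: norm_divide intro!: sum_norm_le mult_left_mono divide_right_mono simp: norm_mult)
  also have "\<dots> \<le> (\<Sum>k\<le>M. norm (euler_coeff k) * B)"
  proof -
    have "0 \<le> B"
      by (rule order_trans[OF norm_ge_zero B[of 0]]) auto
    then have "0 \<le> (\<Sum>k\<le>M. norm (euler_coeff k) * B)"
      by (intro sum_nonneg) auto
    then show ?thesis by simp
  qed
  finally show ?thesis
    by (simp add: sum_distrib_right)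
qed

text \<open>The modulus of a complex power \<open>x powr w\<close> is |x|^(Re w) exp(- Im w Arg x),
  and |Arg x| is at most pi.\<close>

lemma norm_powr_deriv_le:
  "norm (powr_deriv m s x) \<le>
     norm (pochhammer s m) * exp (pi * \<bar>Im s\<bar>) * norm x powr (- Re s - of_nat m)"
proof -
  have "Im s * Arg x \<le> pi * \<bar>Im s\<bar>"
  proof -
    have "\<bar>Arg x\<bar> \<le> pi"
      using Arg_bounded[of x] by (auto simp: abs_le_iff)
    then have "\<bar>Im s\<bar> * \<bar>Arg x\<bar> \<le> \<bar>Im s\<bar> * pi"
      by (intro mult_left_mono) auto
    then show ?thesis
      by (metis abs_le_D1 abs_mult mult.commute)
  qed
  then show ?thesis
    by (auto simp: powr_deriv_def norm_mult norm_power norm_powr_complex mult_ac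
             intro!: mult_left_mono mult_right_mono)
qed

lemma norm_pochhammer_le:
  fixes s :: "'a::{real_normed_algebra_1, comm_semiring_1}"
  assumes "norm s \<le> r"
  shows "norm (pochhammer s m) \<le> pochhammer r m"
proof (induction m)
  case (Suc m)
  have "norm (s + of_nat m) \<le> r + of_nat m"
    using assms norm_triangle_ineq[of s "of_nat m"] by simp
  then have "norm (pochhammer s m) * norm (s + of_nat m) \<le> pochhammer r m * (r + of_nat m)"
    using Suc.IH by (intro mult_mono) (auto intro: order_trans[OF norm_ge_zero])
  then show ?case
    unfolding pochhammer_Suc using norm_mult_ineq order_trans by blast
qed simp

text \<open>This is uniform on the disc of radius \<open>r\<close>: there Re s is at least -r, and
  for |x| \<ge> 1 the real exponent may be raised to the integer -(m - r).\<close>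

lemma norm_powr_deriv_le_power:
  assumes "norm s \<le> real r" "r \<le> m" "1 \<le> norm x"
  shows "norm (powr_deriv m s x) \<le> pochhammer (real r) m * exp (pi * r) * (1 / norm x) ^ (m - r)"
proof -
  have "norm x powr (- Re s - real m) \<le> norm x powr (- real (m - r))"
    using assms abs_Re_le_cmod[of s] by (intro powr_mono) (auto simp: of_nat_diff)
  also have "\<dots> = (1 / norm x) ^ (m - r)"
    using assms by (subst powr_minus, subst powr_realpow) (auto simp: power_one_over field_simps)
  finally have "norm x powr (- Re s - real m) \<le> (1 / norm x) ^ (m - r)" .
  moreover have "pi * \<bar>Im s\<bar> \<le> pi * real r"
    using assms abs_Im_le_cmod[of s] by (intro mult_left_mono) auto
  ultimately show ?thesis
    using norm_pochhammer_le[OF assms(1), of m]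
    by (intro order_trans[OF norm_powr_deriv_le] mult_mono)
       (auto intro!: mult_nonneg_nonneg intro: order_trans[OF norm_ge_zero])
qed

section \<open>Holomorphy in s, decay at infinity and telescoping\<close>

lemma holomorphic_on_powr_deriv:
  assumes "x \<noteq> 0"
  shows "(\<lambda>s. powr_deriv m s x) holomorphic_on A"
  unfolding powr_deriv_def pochhammer_prod using assms
  by (intro holomorphic_intros)

lemma holomorphic_on_boole_sum:
  assumes "x \<noteq> 0"
  shows "(\<lambda>s. boole_sum M s x) holomorphic_on A"
  unfolding boole_sum_def using assms
  by (intro holomorphic_intros holomorphic_on_powr_deriv) auto

lemma holomorphic_on_boole_defect:
  assumes "x \<noteq> 0" "x + 1 \<noteq> 0"
  shows "(\<lambda>s. boole_defect M s x) holomorphic_on A"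
  unfolding boole_defect_def using assms
  by (intro holomorphic_intros holomorphic_on_boole_sum) auto

lemma powr_deriv_tendsto_0:
  assumes "0 < Re s"
  shows "(powr_deriv m s \<longlongrightarrow> 0) at_infinity"
proof (rule Lim_null_comparison)
  let ?C = "norm (pochhammer s m) * exp (pi * \<bar>Im s\<bar>)"
  show "\<forall>\<^sub>F x in at_infinity. norm (powr_deriv m s x) \<le> ?C * norm x powr (- Re s - of_nat m)"
    by (simp add: norm_powr_deriv_le)
  have "((\<lambda>x::complex. norm x powr (- Re s - of_nat m)) \<longlongrightarrow> 0) at_infinity"
    using assms by (intro tendsto_neg_powr filterlim_norm_at_top) auto
  from tendsto_mult_left[OF this, of ?C]
  show "((\<lambda>x. ?C * norm (x::complex) powr (- Re s - of_nat m)) \<longlongrightarrow> 0) at_infinity"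
    by simp
qed

lemma boole_sum_tendsto_0:
  assumes "0 < Re s"
  shows "(boole_sum M s \<longlongrightarrow> 0) at_infinity"
proof -
  have "((\<lambda>x. (\<Sum>k\<le>M. euler_coeff k * powr_deriv k s x) / 2) \<longlongrightarrow>
      (\<Sum>k\<le>M. euler_coeff k * 0) / 2) at_infinity"
    using assms by (intro tendsto_intros powr_deriv_tendsto_0) auto
  then show ?thesis
    by (simp add: boole_sum_def[abs_def])
qed

lemma filterlim_add_of_nat_at_infinity:
  "filterlim (\<lambda>N. (q :: 'a :: real_normed_algebra_1) + of_nat N) at_infinity sequentially"
  by (intro tendsto_add_filterlim_at_infinity[OF tendsto_const] tendsto_of_nat)

text \<open>Each term is the defect plus G(q + j) + G(q + j + 1); with alternating signs the
  G-values telescope to the two ends.\<close>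

lemma alternating_partial_sum_boole:
  "(\<Sum>j<N. (-1) ^ j * (q + of_nat j) powr - s) =
     boole_sum M s q - (-1) ^ N * boole_sum M s (q + of_nat N) +
     (\<Sum>j<N. (-1) ^ j * boole_defect M s (q + of_nat j))"
proof (induction N)
  case (Suc N)
  have eq: "(q + of_nat N) powr - s = boole_defect M s (q + of_nat N) +
      boole_sum M s (q + of_nat N) + boole_sum M s (q + of_nat (Suc N))"
    by (simp add: boole_defect_def add_ac)
  show ?case
    unfolding sum.lessThan_Suc Suc.IH eq by (simp add: algebra_simps)
qed simp

lemma identity_theorem_right_half_ball:
  assumes "0 < r" "f holomorphic_on ball 0 r" "g holomorphic_on ball 0 r"
    and "\<And>s. s \<in> ball 0 r \<Longrightarrow> 0 < Re s \<Longrightarrow> f s = g s"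
    and "s \<in> ball 0 r"
  shows "f s = g s"
proof (rule analytic_continuation_open[of "ball 0 r \<inter> {s. 0 < Re s}" "ball 0 r" f g])
  show "open (ball 0 r \<inter> {s. 0 < Re s})"
    by (intro open_Int open_ball open_halfspace_Re_gt)
  have "of_real (r / 2) \<in> ball 0 r \<inter> {s. 0 < Re s}"
    using assms(1) by auto
  then show "ball 0 r \<inter> {s. 0 < Re s} \<noteq> {}"
    by blast
qed (use assms in auto)

subsection \<open>Continuation of the alternating Hurwitz zeta function\<close>

text \<open>The constant \<open>c\<close> stands for the sector and does not depend on
  \<open>q\<close>. The assumption \<open>cone\<close> keeps the ray from \<open>q\<close> to the
  right away from 0 at a linear rate, and \<open>far\<close> makes its points have modulus at least
  1.\<close>

locale far_from_cut =
  fixes c :: real and q :: complex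
  assumes c_pos: "0 < c" and c_le_1: "c \<le> 1"
    and far: "1 \<le> c * norm q"
    and cone: "0 \<le> t \<Longrightarrow> c * (norm q + t) \<le> norm (q + of_real t)"
begin

lemma norm_q_ge_1: "1 \<le> norm q"
proof -
  have "c * norm q \<le> 1 * norm q"
    using c_le_1 by (intro mult_right_mono) auto
  with far show ?thesis by simp
qed

lemma norm_add_ge_1:
  assumes "0 \<le> t"
  shows "1 \<le> norm (q + of_real t)"
proof -
  have "c * norm q \<le> c * (norm q + t)"
    using c_pos assms by simp
  with far cone[OF assms] show ?thesis by linarith
qed

text \<open>A point of the ray on the cut could be moved further right onto 0, against
  \<open>norm_add_ge_1\<close>.\<close>

lemma add_notin_nonpos:
  assumes "0 \<le> t"
  shows "q + of_real t \<notin> \<real>\<^sub>\<le>\<^sub>0"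
proof
  assume "q + of_real t \<in> \<real>\<^sub>\<le>\<^sub>0"
  then obtain u where u: "u \<le> 0" "q + of_real t = of_real u"
    by (auto elim!: nonpos_Reals_cases)
  then have "q + of_real (t - u) = 0"
    by (simp add: algebra_simps)
  with norm_add_ge_1[of "t - u"] u assms show False by simp
qed

lemma add_of_nat_nonzero: "q + of_nat j \<noteq> 0"
  using add_notin_nonpos[of "real j"] by auto

lemma q_nonzero: "q \<noteq> 0"
  using add_of_nat_nonzero[of 0] by simp

text \<open>Only \<open>c\<close> enters, not \<open>q\<close>, so the constant can be fixed before
  \<open>q\<close> is chosen and is uniform in the sector.\<close>

definition defect_const :: "nat \<Rightarrow> nat \<Rightarrow> real" where
  "defect_const r M = (\<Sum>k\<le>M. norm (euler_coeff k)) *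
     (pochhammer (real r) (Suc M) * exp (pi * r) / c ^ (Suc M - r))"

lemma defect_const_nonneg: "0 \<le> defect_const r M"
proof -
  have "0 \<le> pochhammer (real r) (Suc M)"
    by (rule order_trans[OF norm_ge_zero norm_pochhammer_le[of "0::complex"]]) simp
  then show ?thesis
    using c_pos by (auto simp: defect_const_def intro!: mult_nonneg_nonneg divide_nonneg_nonneg sum_nonneg)
qed

text \<open>The available decay is (|q| + j)^(-(M + 1 - r)). Two of these powers are spent on
  summability in \<open>j\<close>, using |q| + j \<ge> 1 + j; the others are kept as powers of
  1/|q|.\<close>

lemma norm_defect_le:
  assumes "norm s \<le> real r" "r + 1 \<le> M"
  shows "norm (boole_defect M s (q + of_nat j)) \<le>
    defect_const r M * (1 / norm q) ^ (M - 1 - r) * (1 / (1 + real j)\<^sup>2)"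
proof -
  define L where "L = Suc M - r"
  define P where "P = pochhammer (real r) (Suc M) * exp (pi * r)"
  have P: "0 \<le> P"
    unfolding P_def
    by (intro mult_nonneg_nonneg order_trans[OF norm_ge_zero norm_pochhammer_le[of "0::complex"]]) auto
  have step: "norm (powr_deriv (Suc M) s (q + of_nat j + of_real t)) \<le>
      P * (1 / (c * (norm q + j))) ^ L" if t: "0 \<le> t" for t
  proof -
    have eq: "q + of_nat j + of_real t = q + of_real (j + t)"
      by (simp add: add_ac)
    have "c * (norm q + j) \<le> c * (norm q + (j + t))"
      using c_pos t by simp
    also have "\<dots> \<le> norm (q + of_real (j + t))"
      using t by (intro cone) auto
    finally have le: "c * (norm q + j) \<le> norm (q + of_real (j + t))" .
    have pos: "0 < c * (norm q + j)"
      using c_pos norm_q_ge_1 by (intro mult_pos_pos) auto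
    have "norm (powr_deriv (Suc M) s (q + of_real (j + t))) \<le>
        P * (1 / norm (q + of_real (j + t))) ^ L"
      unfolding P_def L_def using assms t
      by (intro norm_powr_deriv_le_power norm_add_ge_1) auto
    also have "\<dots> \<le> P * (1 / (c * (norm q + j))) ^ L"
      using P le pos by (intro mult_left_mono power_mono frac_le) auto
    finally show ?thesis
      unfolding eq .
  qed
  have "norm (boole_defect M s (q + of_nat j)) \<le>
      (\<Sum>k\<le>M. norm (euler_coeff k)) * (P * (1 / (c * (norm q + j))) ^ L)"
  proof (rule norm_boole_defect_le)
    fix t :: real assume "0 \<le> t"
    then show "q + of_nat j + of_real t \<notin> \<real>\<^sub>\<le>\<^sub>0"
      using add_notin_nonpos[of "j + t"] by (simp add: add_ac)
  qed (use step in auto)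
  also have "\<dots> = defect_const r M * (1 / (norm q + j)) ^ L"
    by (simp add: defect_const_def P_def L_def power_mult_distrib power_divide)
  also have "\<dots> \<le> defect_const r M * ((1 / norm q) ^ (M - 1 - r) * (1 / (1 + real j)\<^sup>2))"
  proof (intro mult_left_mono defect_const_nonneg)
    have "L = (M - 1 - r) + 2"
      using assms by (simp add: L_def)
    then have "(1 / (norm q + j)) ^ L = (1 / (norm q + j)) ^ (M - 1 - r) * (1 / (norm q + j))\<^sup>2"
      by (simp only: power_add)
    also have "\<dots> \<le> (1 / norm q) ^ (M - 1 - r) * (1 / (1 + real j))\<^sup>2"
      using norm_q_ge_1 by (intro mult_mono power_mono frac_le) auto
    finally show "(1 / (norm q + j)) ^ L \<le> (1 / norm q) ^ (M - 1 - r) * (1 / (1 + real j)\<^sup>2)"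
      by (simp add: power_divide)
  qed
  finally show ?thesis
    by (simp only: mult.assoc)
qed

section \<open>The defect series and the entire continuation\<close>

definition defect_series :: "nat \<Rightarrow> complex \<Rightarrow> complex" where
  "defect_series M s = (\<Sum>j. (-1) ^ j * boole_defect M s (q + of_nat j))"

lemma summable_inverse_square: "summable (\<lambda>j. C * (1 / (1 + real j)\<^sup>2))"
  using inverse_squares_sums by (intro summable_mult) (simp add: sums_iff add_ac)

lemma norm_defect_term_le:
  assumes "norm s \<le> real r" "r + 1 \<le> M"
  shows "norm ((-1) ^ j * boole_defect M s (q + of_nat j)) \<le>
    defect_const r M * (1 / norm q) ^ (M - 1 - r) * (1 / (1 + real j)\<^sup>2)"
  using norm_defect_le[OF assms, of j] by (simp add: norm_mult norm_power)

lemma summable_defect_series: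
  assumes "norm s \<le> real r" "r + 1 \<le> M"
  shows "summable (\<lambda>j. (-1) ^ j * boole_defect M s (q + of_nat j))"
  using norm_defect_term_le[OF assms] by (rule summable_comparison_test'[OF summable_inverse_square])

lemma norm_defect_series_le:
  assumes "norm s \<le> real r" "r + 1 \<le> M"
  shows "norm (defect_series M s) \<le>
    defect_const r M * (1 / norm q) ^ (M - 1 - r) * (\<Sum>j. 1 / (1 + real j)\<^sup>2)"
proof -
  have "norm (defect_series M s) \<le>
      (\<Sum>j. defect_const r M * (1 / norm q) ^ (M - 1 - r) * (1 / (1 + real j)\<^sup>2))"
    unfolding defect_series_def
    using norm_defect_term_le[OF assms] by (rule norm_suminf_le[OF _ summable_inverse_square])
  also have "\<dots> = defect_const r M * (1 / norm q) ^ (M - 1 - r) * (\<Sum>j. 1 / (1 + real j)\<^sup>2)"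
    using summable_inverse_square[of 1] by (intro suminf_mult) simp
  finally show ?thesis .
qed

text \<open>The majorant of the terms does not depend on \<open>s\<close>, so the Weierstrass test
  gives locally uniform convergence.\<close>

lemma holomorphic_on_defect_series:
  assumes "r + 1 \<le> M"
  shows "defect_series M holomorphic_on ball 0 (real r)"
proof (rule holomorphic_uniform_sequence[of "ball 0 (real r)"
      "\<lambda>N s. \<Sum>j<N. (-1) ^ j * boole_defect M s (q + of_nat j)"])
  fix N
  show "(\<lambda>s. \<Sum>j<N. (-1) ^ j * boole_defect M s (q + of_nat j)) holomorphic_on ball 0 (real r)"
    using add_of_nat_nonzero add_of_nat_nonzero[of "Suc j" for j]
    by (intro holomorphic_intros holomorphic_on_boole_defect) (auto simp: add_ac)
next
  fix s :: complex assume "s \<in> ball 0 (real r)"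
  then obtain d where d: "d > 0" "cball s d \<subseteq> ball 0 (real r)"
    using open_contains_cball[of "ball 0 (real r)"] open_ball by metis
  have "uniform_limit (cball s d) (\<lambda>N s. \<Sum>j<N. (-1) ^ j * boole_defect M s (q + of_nat j))
      (\<lambda>s. \<Sum>j. (-1) ^ j * boole_defect M s (q + of_nat j)) sequentially"
  proof (rule Weierstrass_m_test[OF _ summable_inverse_square])
    fix j z assume "z \<in> cball s d"
    with d have "norm z \<le> real r" by auto
    then show "norm ((-1) ^ j * boole_defect M z (q + of_nat j)) \<le>
        defect_const r M * (1 / norm q) ^ (M - 1 - r) * (1 / (1 + real j)\<^sup>2)"
      using assms by (rule norm_defect_term_le)
  qed
  with d show "\<exists>d>0. cball s d \<subseteq> ball 0 (real r) \<and> uniform_limit (cball s d)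
      (\<lambda>N s. \<Sum>j<N. (-1) ^ j * boole_defect M s (q + of_nat j)) (defect_series M) sequentially"
    unfolding defect_series_def[abs_def] by blast
qed auto

text \<open>Larger \<open>M\<close> gives a larger disc of holomorphy; by
  \<open>continuation_unique\<close> the versions for different \<open>M\<close> agree on common
  discs.\<close>

definition continuation :: "nat \<Rightarrow> complex \<Rightarrow> complex" where
  "continuation M s = boole_sum M s q + defect_series M s"

lemma holomorphic_on_continuation:
  "r + 1 \<le> M \<Longrightarrow> continuation M holomorphic_on ball 0 (real r)"
  unfolding continuation_def[abs_def]
  by (intro holomorphic_intros holomorphic_on_boole_sum holomorphic_on_defect_series q_nonzero)

lemma sums_continuation:
  assumes "0 < Re s" "norm s \<le> real r" "r + 1 \<le> M"
  shows "(\<lambda>n. (-1) ^ n / (of_nat n + q) powr s) sums continuation M s"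
proof -
  have "(\<lambda>N. boole_sum M s (q + of_nat N)) \<longlonglongrightarrow> 0"
    by (rule filterlim_compose[OF boole_sum_tendsto_0 filterlim_add_of_nat_at_infinity]) fact
  then have "(\<lambda>N. (-1) ^ N * boole_sum M s (q + of_nat N)) \<longlonglongrightarrow> 0"
    by (subst (asm) tendsto_norm_zero_iff[symmetric], subst tendsto_norm_zero_iff[symmetric])
       (simp add: norm_mult norm_power)
  moreover have "(\<lambda>N. \<Sum>j<N. (-1) ^ j * boole_defect M s (q + of_nat j)) \<longlonglongrightarrow> defect_series M s"
    unfolding defect_series_def
    using summable_defect_series[OF assms(2,3)] by (rule summable_LIMSEQ)
  ultimately have "(\<lambda>N. boole_sum M s q - (-1) ^ N * boole_sum M s (q + of_nat N) +
     (\<Sum>j<N. (-1) ^ j * boole_defect M s (q + of_nat j))) \<longlonglongrightarrow> boole_sum M s q - 0 + defect_series M s"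
    by (intro tendsto_intros)
  then show ?thesis
    unfolding alternating_partial_sum_boole[symmetric] sums_def
    by (simp add: continuation_def powr_minus divide_inverse add_ac)
qed

lemma continuation_unique:
  assumes "0 < r" "f holomorphic_on ball 0 (real r)" "r + 1 \<le> M"
    and "\<And>s. 0 < Re s \<Longrightarrow> norm s < real r \<Longrightarrow> (\<lambda>n. (-1) ^ n / (of_nat n + q) powr s) sums f s"
    and "norm s < real r"
  shows "f s = continuation M s"
proof (rule identity_theorem_right_half_ball[of "real r" f "continuation M"])
  show "continuation M holomorphic_on ball 0 (real r)"
    using assms(3) by (rule holomorphic_on_continuation)
  show "f s = continuation M s" if "s \<in> ball 0 (real r)" "0 < Re s" for s
    using sums_unique2[OF assms(4)[of s] sums_continuation[of s r M]] that assms(3) by auto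
qed (use assms in auto)

text \<open>The functions on discs are glued to one entire function, which is then shown to be the
  unique one described by the definite description in \<open>alt_hurwitz_zeta\<close>.\<close>

lemma alt_hurwitz_zeta_eq_continuation:
  assumes "norm s < real r" "r + 1 \<le> M"
  shows "alt_hurwitz_zeta s q = continuation M s"
proof -
  \<comment> \<open>The radius floor(|s|) + 1 exceeds |s|, and \<open>M\<close> is one more than
    this radius, the least value that the holomorphy lemma allows for it.\<close>
  define F where "F s = continuation (nat \<lfloor>norm s\<rfloor> + 2) s" for s
  have F: "F s = continuation M s" if "norm s < real r" "r + 1 \<le> M" for s r M
    unfolding F_def
  proof (rule continuation_unique[of "nat \<lfloor>norm s\<rfloor> + 1" "continuation (nat \<lfloor>norm s\<rfloor> + 2)"])
    have "nat \<lfloor>norm s\<rfloor> + 1 \<le> r"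
      using that by (simp add: Suc_le_eq nat_less_iff floor_less_iff)
    with that show "nat \<lfloor>norm s\<rfloor> + 1 + 1 \<le> M"
      by linarith
    show "norm s < real (nat \<lfloor>norm s\<rfloor> + 1)"
      by linarith
    show "continuation (nat \<lfloor>norm s\<rfloor> + 2) holomorphic_on ball 0 (real (nat \<lfloor>norm s\<rfloor> + 1))"
      by (rule holomorphic_on_continuation) simp
    show "(\<lambda>n. (-1) ^ n / (of_nat n + q) powr z) sums continuation (nat \<lfloor>norm s\<rfloor> + 2) z"
      if "0 < Re z" "norm z < real (nat \<lfloor>norm s\<rfloor> + 1)" for z
      using that by (intro sums_continuation[of z "nat \<lfloor>norm s\<rfloor> + 1"]) auto
  qed simp
  have sums_F: "(\<lambda>n. (-1) ^ n / (of_nat n + q) powr z) sums F z" if "0 < Re z" for z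
    unfolding F_def using that
    by (intro sums_continuation[of z "nat \<lfloor>norm z\<rfloor> + 1"]) (auto, linarith)
  have hol_F: "F holomorphic_on UNIV"
  proof (rule holomorphic_on_subset)
    have "F holomorphic_on ball 0 (real r)" for r
      using holomorphic_on_continuation[of r "r + 1"] F[of _ r "r + 1"]
      by (subst holomorphic_cong[OF refl, of _ _ "continuation (r + 1)"]) auto
    then show "F holomorphic_on (\<Union>r::nat. ball 0 (real r))"
      by (intro holomorphic_on_UN_open) auto
    show "UNIV \<subseteq> (\<Union>r::nat. ball 0 (real r))"
      using reals_Archimedean2 by auto
  qed
  have "alt_hurwitz_zeta s q = F s"
    unfolding alt_hurwitz_zeta_def
  proof (rule fun_cong[OF the_equality])
    fix f :: "complex \<Rightarrow> complex"
    assume f: "f holomorphic_on UNIV \<and>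
      (\<forall>z. Re z > 0 \<longrightarrow> (\<lambda>n. (-1) ^ n / (of_nat n + q) powr z) sums f z)"
    show "f = F"
    proof
      fix z :: complex
      obtain r :: nat where r: "norm z < real r"
        using reals_Archimedean2 by blast
      have "f z = continuation (r + 1) z"
        using f r by (intro continuation_unique[of r f]) (auto intro: holomorphic_on_subset intro!: Nat.gr0I)
      with F[OF r, of "r + 1"] show "f z = F z" by simp
    qed
  qed (use hol_F sums_F in auto)
  with F[OF assms] show ?thesis by simp
qed

text \<open>Cauchy's inequality on the circle of radius 1/2 about -r, whence the factor 2. The
  circle lies in the disc of radius r + 1, so the bound is taken for \<open>r + 1\<close> and one
  power of 1/|q| is lost.\<close>

lemma norm_deriv_defect_series_le:
  assumes "r + 2 \<le> M"
  shows "norm (deriv (defect_series M) (- of_nat r)) \<le>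
    2 * (defect_const (r + 1) M * (1 / norm q) ^ (M - 2 - r) * (\<Sum>j. 1 / (1 + real j)\<^sup>2))"
    (is "_ \<le> 2 * ?B")
proof -
  have sub: "norm z < real (r + 1)" if "z \<in> cball (- of_nat r) (1 / 2)" for z :: complex
    using that norm_triangle_ineq2[of z "- of_nat r"] by (simp add: dist_norm norm_minus_commute)
  have hol: "defect_series M holomorphic_on cball (- of_nat r) (1 / 2)"
    using sub assms
    by (intro holomorphic_on_subset[OF holomorphic_on_defect_series[of "r + 1" M]])
       (auto simp: subset_iff)
  have "norm ((deriv ^^ 1) (defect_series M) (- of_nat r)) \<le> fact 1 * ?B / (1 / 2) ^ 1"
  proof (rule Cauchy_inequality)
    show "defect_series M holomorphic_on ball (- of_nat r) (1 / 2)"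
      using hol by (rule holomorphic_on_subset) auto
    show "continuous_on (cball (- of_nat r) (1 / 2)) (defect_series M)"
      using hol by (rule holomorphic_on_imp_continuous_on)
    fix z :: complex assume "norm (- of_nat r - z) = 1 / 2"
    then have "norm z < real (r + 1)"
      by (intro sub) (simp add: dist_norm)
    then show "norm (defect_series M z) \<le> ?B"
      using norm_defect_series_le[of z "r + 1" M] assms by (simp add: numeral_2_eq_2)
  qed simp
  then show ?thesis by simp
qed

lemma deriv_alt_hurwitz_zeta:
  assumes "r + 2 \<le> M"
  shows "deriv (\<lambda>s. alt_hurwitz_zeta s q) (- of_nat r) =
    deriv (\<lambda>s. boole_sum M s q) (- of_nat r) + deriv (defect_series M) (- of_nat r)"
proof -
  have in_ball: "- of_nat r \<in> ball (0 :: complex) (real (r + 1))"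
    by simp
  have "\<forall>\<^sub>F s in nhds (- of_nat r). alt_hurwitz_zeta s q = boole_sum M s q + defect_series M s"
    unfolding eventually_nhds
    by (intro exI[of _ "ball 0 (real (r + 1))"] conjI open_ball in_ball)
       (use assms alt_hurwitz_zeta_eq_continuation[of _ "r + 1" M] in \<open>auto simp: continuation_def\<close>)
  then have "deriv (\<lambda>s. alt_hurwitz_zeta s q) (- of_nat r) =
      deriv (\<lambda>s. boole_sum M s q + defect_series M s) (- of_nat r)"
    by (rule deriv_cong_ev) simp
  also have "\<dots> = deriv (\<lambda>s. boole_sum M s q) (- of_nat r) + deriv (defect_series M) (- of_nat r)"
    using in_ball assms
    by (intro deriv_add holomorphic_on_imp_differentiable_at[OF _ open_ball in_ball]
        holomorphic_on_boole_sum holomorphic_on_defect_series q_nonzero) auto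
  finally show ?thesis .
qed

end

subsection \<open>The derivative at a nonpositive integer\<close>

text \<open>For m > n the factor x - n occurs in the falling product and vanishes at n, so the
  derivative there is the product of the other factors over m!. Those with i < n give n!, those with
  i > n a signed factorial.\<close>

lemma has_field_derivative_gbinomial_greater:
  assumes "n < m"
  shows "((\<lambda>x::complex. x gchoose m) has_field_derivative
    (-1) ^ (m - 1 - n) * fact n * fact (m - 1 - n) / fact m) (at (of_nat n))"
proof -
  define g where "g x = (\<Prod>i\<in>{..<m} - {n}. x - of_nat i)" for x :: complex
  have eq: "x gchoose m = (x - of_nat n) * g x / fact m" for x :: complex
    using assms by (simp add: gbinomial_prod_rev g_def atLeast0LessThan prod.remove[of "{..<m}" n])
  have "g (of_nat n) = (\<Prod>i<n. of_nat n - of_nat i) * (\<Prod>i\<in>{n<..<m}. of_nat n - of_nat i)"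
  proof -
    have "{..<m} - {n} = {..<n} \<union> {n<..<m}"
      using assms by auto
    moreover have "{..<n} \<inter> {n<..<m} = {}"
      by auto
    ultimately show ?thesis
      unfolding g_def by (simp add: prod.union_disjoint)
  qed
  also have "(\<Prod>i<n. of_nat n - of_nat i :: complex) = fact n"
    by (simp add: fact_prod_rev atLeast0LessThan of_nat_prod of_nat_diff)
  also have "(\<Prod>i\<in>{n<..<m}. of_nat n - of_nat i :: complex) = (\<Prod>i=1..m - 1 - n. - of_nat i)"
    by (rule prod.reindex_bij_witness[of _ "\<lambda>i. i + n" "\<lambda>i. i - n"]) (auto simp: of_nat_diff)
  also have "\<dots> = (-1) ^ (m - 1 - n) * fact (m - 1 - n)"
    by (simp add: prod_uminus fact_prod)
  finally have g_n: "g (of_nat n) = (-1) ^ (m - 1 - n) * fact n * fact (m - 1 - n)"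
    by simp
  have "g field_differentiable at (of_nat n)"
    unfolding g_def[abs_def] by (intro holomorphic_on_imp_differentiable_at[of _ UNIV] holomorphic_intros) auto
  then obtain g' where "(g has_field_derivative g') (at (of_nat n))"
    by (auto simp: field_differentiable_def)
  then have "((\<lambda>x. (x - of_nat n) * g x / fact m) has_field_derivative g (of_nat n) / fact m) (at (of_nat n))"
    by (auto intro!: derivative_eq_intros)
  then show ?thesis
    by (simp add: eq g_n)
qed

text \<open>
  The formula comes from differentiating Vandermonde's convolution
  \<open>n + h gchoose m = (\<Sum>k\<le>m. (n choose k) * (h gchoose (m - k)))\<close> at \<open>h = 0\<close>.
\<close>

definition gbinomial_deriv :: "nat \<Rightarrow> nat \<Rightarrow> complex" where
  "gbinomial_deriv n m = (\<Sum>j<m. of_nat (n choose j) * ((-1) ^ (m - 1 - j) / of_nat (m - j)))"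

lemma has_field_derivative_gbinomial:
  "((\<lambda>x. x gchoose m) has_field_derivative gbinomial_deriv n m) (at (of_nat n))"
proof -
  \<comment> \<open>\<open>d i\<close> is the derivative of \<open>x gchoose i\<close> at 0; for i =
    0 the function is constant.\<close>
  define d :: "nat \<Rightarrow> complex" where "d i = (if i = 0 then 0 else (-1) ^ (i - 1) / of_nat i)" for i
  have d: "((\<lambda>x. x gchoose i) has_field_derivative d i) (at 0)" for i
  proof (cases i)
    case (Suc j)
    with has_field_derivative_gbinomial_greater[of 0 i] show ?thesis
      by (simp add: d_def field_simps del: of_nat_Suc)
  qed (simp add: d_def)
  have "((\<lambda>x. (x - of_nat n) gchoose i) has_field_derivative d i * 1) (at (of_nat n))" for i
    by (rule DERIV_chain2[of "\<lambda>x. x gchoose i"]) (use d in \<open>auto intro!: derivative_eq_intros\<close>)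
  then have "((\<lambda>x. \<Sum>k=0..m. (of_nat n gchoose k) * ((x - of_nat n) gchoose (m - k)))
      has_field_derivative (\<Sum>k=0..m. (of_nat n gchoose k) * d (m - k))) (at (of_nat n))"
    by (intro DERIV_sum DERIV_cmult) simp
  moreover have "(\<Sum>k=0..m. (of_nat n gchoose k) * d (m - k)) = gbinomial_deriv n m"
    unfolding gbinomial_deriv_def
    by (intro sum.mono_neutral_cong_right)
       (auto simp: d_def binomial_gbinomial diff_commute)
  ultimately show ?thesis
    by (simp add: gbinomial_Vandermonde)
qed

text \<open>Both sides are the derivative of \<open>x gchoose m\<close> at \<open>n\<close>. This
  turns the finite sum into the factorial quotient of the tail of the expansion.\<close>

lemma gbinomial_deriv_greater:
  assumes "n < m"
  shows "gbinomial_deriv n m = (-1) ^ (m - 1 - n) * fact n * fact (m - 1 - n) / fact m"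
  by (rule DERIV_unique[OF has_field_derivative_gbinomial has_field_derivative_gbinomial_greater[OF assms]])

lemma powr_deriv_gbinomial:
  "powr_deriv m s x = fact m * ((- s) gchoose m) * x powr (- s - of_nat m)"
  by (simp add: powr_deriv_def gbinomial_pochhammer)

text \<open>Product rule in \<open>s\<close>. The logarithm carries an ordinary binomial
  coefficient, so it disappears for m > n.\<close>

lemma has_field_derivative_powr_deriv_param:
  assumes "x \<noteq> 0"
  shows "((\<lambda>s. powr_deriv m s x) has_field_derivative
    - (fact m * (gbinomial_deriv n m + of_nat (n choose m) * Ln x) * x powi (int n - int m)))
    (at (- of_nat n))"
proof -
  have "((\<lambda>s. (- s) gchoose m) has_field_derivative gbinomial_deriv n m * (- 1)) (at (- of_nat n))"
    by (rule DERIV_chain2[of "\<lambda>x. x gchoose m"])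
       (use has_field_derivative_gbinomial in \<open>auto intro!: derivative_eq_intros\<close>)
  moreover have "((\<lambda>s. x powr (- s - of_nat m)) has_field_derivative
      (- Ln x) * x powr (of_nat n - of_nat m)) (at (- of_nat n))"
    using assms unfolding powr_def by (auto intro!: derivative_eq_intros)
  ultimately have "((\<lambda>s. fact m * (((- s) gchoose m) * x powr (- s - of_nat m))) has_field_derivative
      fact m * (gbinomial_deriv n m * (- 1) * x powr (- (- of_nat n) - of_nat m) +
        ((- Ln x) * x powr (of_nat n - of_nat m)) * ((- (- of_nat n)) gchoose m))) (at (- of_nat n))"
    by (intro DERIV_cmult DERIV_mult)
  moreover have "x powr (of_nat n - of_nat m) = x powi (int n - int m)"
    using complex_powr_of_int[of x "int n - int m"] assms by simp
  ultimately show ?thesis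
    by (simp add: powr_deriv_gbinomial binomial_gbinomial algebra_simps)
qed

text \<open>By \<open>n \<le> M\<close> all logarithmic terms are present, and they assemble to the
  Euler polynomial.\<close>

lemma deriv_boole_sum:
  assumes "x \<noteq> 0" "n \<le> M"
  shows "deriv (\<lambda>s. boole_sum M s x) (- of_nat n) = - 1 / 2 * euler_poly n x * Ln x
    - 1 / 2 * (\<Sum>m\<le>M. euler_poly m 0 * gbinomial_deriv n m * x powi (int n - int m))"
proof -
  have "((\<lambda>s. boole_sum M s x) has_field_derivative
      (\<Sum>m\<le>M. euler_coeff m * - (fact m * (gbinomial_deriv n m + of_nat (n choose m) * Ln x) *
        x powi (int n - int m))) / 2) (at (- of_nat n))"
    unfolding boole_sum_def using assms
    by (intro DERIV_cdivide DERIV_sum DERIV_cmult has_field_derivative_powr_deriv_param)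
  then have "deriv (\<lambda>s. boole_sum M s x) (- of_nat n) =
      (\<Sum>m\<le>M. euler_coeff m * - (fact m * (gbinomial_deriv n m + of_nat (n choose m) * Ln x) *
        x powi (int n - int m))) / 2"
    by (rule DERIV_imp_deriv)
  also have "\<dots> = - 1 / 2 * (\<Sum>m\<le>M. of_nat (n choose m) * euler_poly m 0 * x powi (int n - int m)) * Ln x
    - 1 / 2 * (\<Sum>m\<le>M. euler_poly m 0 * gbinomial_deriv n m * x powi (int n - int m))"
    unfolding sum_distrib_left sum_distrib_right sum_divide_distrib sum_subtractf[symmetric]
    by (intro sum.cong refl) (simp add: euler_poly_0 field_simps)
  also have "(\<Sum>m\<le>M. of_nat (n choose m) * euler_poly m 0 * x powi (int n - int m)) = euler_poly n x"
    unfolding euler_poly_binomial_sum[OF assms(2)]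
  proof (intro sum.cong refl)
    fix m
    show "of_nat (n choose m) * euler_poly m 0 * x powi (int n - int m) =
        of_nat (n choose m) * euler_poly m 0 * x ^ (n - m)"
      \<comment> \<open>For m > n the truncated exponent \<open>n - m\<close> is harmless because
        the binomial is 0.\<close>
      by (cases "m \<le> n") (auto simp: of_nat_diff[symmetric] simp del: of_nat_diff)
  qed
  finally show ?thesis .
qed

lemma sum_atMost_odd:
  fixes a :: "nat \<Rightarrow> 'a::comm_monoid_add"
  shows "(\<Sum>m\<le>2 * N + 1. a m) = (\<Sum>k\<le>N. a (2 * k) + a (2 * k + 1))"
  by (induction N) (simp_all add: add_ac)

lemma prod_falling_times_fact:
  "n < m \<Longrightarrow> (\<Prod>i = 0..n. of_nat (m - i)) * fact (m - 1 - n) = (fact m :: 'a::{comm_semiring_1, semiring_char_0})"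
proof (induction n)
  case 0
  then show ?case
    by (cases m) auto
next
  case (Suc n)
  then have "m - 1 - n = Suc (m - 1 - Suc n)" "m - Suc n = m - 1 - n"
    by auto
  then have "fact (m - 1 - n) = of_nat (m - Suc n) * (fact (m - 1 - Suc n) :: 'a)"
    by (metis fact_Suc)
  with Suc show ?case
    by (simp add: mult.assoc)
qed

text \<open>Even positive indices drop out since E vanishes there at 0, and index 0 because
  \<open>gbinomial_deriv n 0\<close> is an empty sum. Index 1 gives the leading term, with 1/4 =
  (-1/2)(-1/2).\<close>

lemma deriv_boole_sum_odd:
  assumes "x \<noteq> 0" "n \<ge> 1" "n \<le> 2 * N + 1"
  shows "deriv (\<lambda>s. boole_sum (2 * N + 1) s x) (- of_nat n) =
    1 / 4 * x ^ (n - 1) - 1 / 2 * euler_poly n x * Ln x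
    - 1 / 2 * (\<Sum>k=1..N. euler_poly (2 * k + 1) 0 * gbinomial_deriv n (2 * k + 1) *
        x powi (int n - 2 * int k - 1))"
proof -
  let ?a = "\<lambda>m. euler_poly m 0 * gbinomial_deriv n m * x powi (int n - int m)"
  have a0: "?a 0 = 0"
    by (simp add: gbinomial_deriv_def)
  have a1: "?a 1 = - 1 / 2 * x ^ (n - 1)"
  proof -
    have "x powi (int n - int 1) = x ^ (n - 1)"
      using assms(2) by (metis of_nat_diff power_int_of_nat)
    then show ?thesis
      unfolding euler_poly_1_0 by (simp add: gbinomial_deriv_def)
  qed
  have "(\<Sum>m\<le>2 * N + 1. ?a m) = (\<Sum>k\<le>N. ?a (2 * k) + ?a (2 * k + 1))"
    by (rule sum_atMost_odd)
  also have "\<dots> = (\<Sum>k\<in>insert 0 {1..N}. ?a (2 * k) + ?a (2 * k + 1))"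
    by (intro sum.cong) auto
  also have "\<dots> = ?a 0 + ?a 1 + (\<Sum>k=1..N. ?a (2 * k) + ?a (2 * k + 1))"
    by (subst sum.insert) auto
  also have "(\<Sum>k=1..N. ?a (2 * k) + ?a (2 * k + 1)) =
      (\<Sum>k=1..N. euler_poly (2 * k + 1) 0 * gbinomial_deriv n (2 * k + 1) *
        x powi (int n - 2 * int k - 1))"
    by (intro sum.cong refl) (auto simp: euler_poly_0_even algebra_simps)
  finally have sum_eq: "(\<Sum>m\<le>2 * N + 1. ?a m) = - 1 / 2 * x ^ (n - 1) +
      (\<Sum>k=1..N. euler_poly (2 * k + 1) 0 * gbinomial_deriv n (2 * k + 1) *
        x powi (int n - 2 * int k - 1))"
    unfolding a0 a1 by simp
  show ?thesis
    unfolding deriv_boole_sum[OF assms(1,3)] sum_eq by (simp add: algebra_simps)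
qed

section \<open>Geometry of the sector and the final estimate\<close>

text \<open>The law of cosines bounds |q + t|^2 below by |q|^2 - 2 |q| t cos d + t^2, which equals
  sin(d/2)^2 (|q| + t)^2 + cos(d/2)^2 (|q| - t)^2.\<close>

lemma norm_add_of_real_ge:
  assumes "0 < d" "d \<le> pi" "\<bar>Arg q\<bar> \<le> pi - d" "0 \<le> t"
  shows "sin (d / 2) * (norm q + t) \<le> norm (q + of_real t)"
proof (rule power2_le_imp_le)
  have "cos (pi - d) \<le> cos \<bar>Arg q\<bar>"
    using assms by (intro cos_monotone_0_pi_le) auto
  then have "- cos d * norm q \<le> cos (Arg q) * norm q"
    by (intro mult_right_mono) auto
  also have "\<dots> = Re q"
    by (metis Re_rcis mult.commute rcis_cmod_Arg)
  finally have "t * (- cos d * norm q) \<le> t * Re q"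
    using assms by (intro mult_left_mono)
  moreover have "(norm (q + of_real t))\<^sup>2 = (norm q)\<^sup>2 + 2 * (t * Re q) + t\<^sup>2"
    unfolding cmod_power2 by (simp add: power2_eq_square algebra_simps)
  ultimately have "(norm q)\<^sup>2 - 2 * (cos d * norm q * t) + t\<^sup>2 \<le> (norm (q + of_real t))\<^sup>2"
    by (simp add: algebra_simps)
  moreover have "0 \<le> (1 + cos d) / 2 * (norm q - t)\<^sup>2"
    by (metis add.commute cos_ge_minus_one diff_ge_0_iff_ge diff_minus_eq_add divide_nonneg_pos mult_nonneg_nonneg zero_le_power2 zero_less_numeral)
  moreover have sin_half: "(sin (d / 2))\<^sup>2 = (1 - cos d) / 2"
    using cos_double_sin[of "d / 2"] by simp
  moreover have "(1 - cos d) / 2 * (norm q + t)\<^sup>2 =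
      (norm q)\<^sup>2 - 2 * (cos d * norm q * t) + t\<^sup>2 - (1 + cos d) / 2 * (norm q - t)\<^sup>2"
    by (simp add: power2_eq_square field_simps)
  ultimately show "(sin (d / 2) * (norm q + t))\<^sup>2 \<le> (norm (q + of_real t))\<^sup>2"
    unfolding power_mult_distrib sin_half by linarith
qed simp

theorem corollary3p12:
  fixes \<delta> :: real and n K :: nat
  assumes "\<delta> > 0" and "n \<ge> 2" and "K \<ge> n div 2"
  shows "(\<lambda>q::complex.
            deriv (\<lambda>s. alt_hurwitz_zeta s q) (- of_nat n)
            - (1 / 4 * q ^ (n - 1)
               - 1 / 2 * euler_poly n q * Ln q
               - 1 / 2 * (\<Sum>k = 1..n div 2. euler_poly (2 * k + 1) 0
                   * (\<Sum>j = 0..2 * k. of_nat (n choose j) * ((-1) ^ j / of_nat (2 * k - j + 1)))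
                   * q powi (int n - 2 * int k - 1))
               + (-1) ^ (n + 1) * (fact n / 2) * (\<Sum>k = n div 2 + 1..K.
                   euler_poly (2 * k + 1) 0 / (\<Prod>i = 0..n. of_nat (2 * k + 1 - i))
                   * q powi (int n - 2 * int k - 1))))
         \<in> O[inf at_infinity (principal {q. \<bar>Arg q\<bar> \<le> pi - \<delta>})](\<lambda>q. of_real (norm q powi (int n - 2 * int K - 3)))"
proof -
  \<comment> \<open>Capping at pi keeps sin(d/2) positive; for \<delta> > pi the sector is
    empty.\<close>
  define d where "d = min \<delta> pi"
  define c where "c = sin (d / 2)"
  have d: "0 < d" "d \<le> pi"
    using assms(1) by (auto simp: d_def)
  then have c: "0 < c" "c \<le> 1"
    by (auto simp: c_def intro!: sin_gt_zero)
  define N where "N = n div 2"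
  \<comment> \<open>The Cauchy estimate on a circle about \<open>-n\<close> and the summation over \<open>j\<close> cost powers of \<open>q\<close>,
    so the expansion is carried two odd terms past \<open>K\<close>.\<close>
  define M where "M = 2 * (K + 2) + 1"
  \<comment> \<open>One formula for the terms of both sums: \<open>b_le\<close> gives the shape used
    up to n/2, \<open>b_gt\<close> the shape used beyond.\<close>
  define b where "b k q = - 1 / 2 * (euler_poly (2 * k + 1) 0 * gbinomial_deriv n (2 * k + 1) *
      q powi (int n - 2 * int k - 1))" for k and q :: complex
  have b_le: "b k q = - 1 / 2 * (euler_poly (2 * k + 1) 0
      * (\<Sum>j = 0..2 * k. of_nat (n choose j) * ((-1) ^ j / of_nat (2 * k - j + 1)))
      * q powi (int n - 2 * int k - 1))" for k q
  proof -
    have "gbinomial_deriv n (2 * k + 1) =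
        (\<Sum>j = 0..2 * k. of_nat (n choose j) * ((-1) ^ j / of_nat (2 * k - j + 1)))"
      unfolding gbinomial_deriv_def
    proof (intro sum.cong)
      fix j assume "j \<in> {0..2 * k}"
      then have "2 * k + 1 - 1 - j + 2 * j = 2 * k + j" "2 * k + 1 - j = 2 * k - j + 1"
        by auto
      moreover from this have "(-1 :: complex) ^ (2 * k + 1 - 1 - j) = (-1) ^ j"
        by (metis even_add even_mult_iff even_numeral neg_one_even_power neg_one_odd_power)
      ultimately show "of_nat (n choose j) * ((-1) ^ (2 * k + 1 - 1 - j) / of_nat (2 * k + 1 - j)) =
          of_nat (n choose j) * ((-1 :: complex) ^ j / of_nat (2 * k - j + 1))"
        by simp
    qed auto
    then show ?thesis
      by (simp add: b_def)
  qed
  have b_gt: "b k q = (-1) ^ (n + 1) * (fact n / 2) *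
      (euler_poly (2 * k + 1) 0 / (\<Prod>i = 0..n. of_nat (2 * k + 1 - i))
        * q powi (int n - 2 * int k - 1))" if "k > N" for k q
  proof -
    define P :: complex where "P = (\<Prod>i = 0..n. of_nat (2 * k + 1 - i))"
    have lt: "n < 2 * k + 1"
      using that by (simp add: N_def)
    then have P: "P * fact (2 * k - n) = fact (2 * k + 1)"
      using prod_falling_times_fact[of n "2 * k + 1", where ?'a = complex] by (simp add: P_def)
    then have "P \<noteq> 0"
      by (metis fact_nonzero mult_zero_left)
    have "(-1 :: complex) ^ (2 * k - n) = (-1) ^ n"
      using lt by (simp add: minus_one_power_iff)
    then have "gbinomial_deriv n (2 * k + 1) = (-1) ^ n * fact n * fact (2 * k - n) / (P * fact (2 * k - n))"
      using gbinomial_deriv_greater[OF lt] unfolding P by simp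
    then have eq: "gbinomial_deriv n (2 * k + 1) = (-1) ^ n * fact n / P"
      by simp
    show ?thesis
      unfolding b_def P_def[symmetric] eq by simp
  qed
  \<comment> \<open>The first summand bounds the defect; the others are the coefficient sizes of the
    two terms past \<open>K\<close>, read off at q = 1.\<close>
  define C where "C = 2 * (far_from_cut.defect_const c (n + 1) M * (\<Sum>j. 1 / (1 + real j)\<^sup>2)) +
    norm (b (K + 1) 1) + norm (b (K + 2) 1)"
  let ?B = "\<lambda>q::complex. norm q powi (int n - 2 * int K - 3)"
  have "norm (deriv (\<lambda>s. alt_hurwitz_zeta s q) (- of_nat n)
            - (1 / 4 * q ^ (n - 1)
               - 1 / 2 * euler_poly n q * Ln q
               - 1 / 2 * (\<Sum>k = 1..n div 2. euler_poly (2 * k + 1) 0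
                   * (\<Sum>j = 0..2 * k. of_nat (n choose j) * ((-1) ^ j / of_nat (2 * k - j + 1)))
                   * q powi (int n - 2 * int k - 1))
               + (-1) ^ (n + 1) * (fact n / 2) * (\<Sum>k = n div 2 + 1..K.
                   euler_poly (2 * k + 1) 0 / (\<Prod>i = 0..n. of_nat (2 * k + 1 - i))
                   * q powi (int n - 2 * int k - 1))))
        \<le> C * norm (of_real (?B q) :: complex)" (is "norm (?D - ?E) \<le> _")
    if q: "\<bar>Arg q\<bar> \<le> pi - \<delta>" "1 / c \<le> norm q" for q
  proof -
    interpret far_from_cut c q
    proof
      show "1 \<le> c * norm q"
        using q(2) c by (simp add: field_simps)
      fix t :: real assume "0 \<le> t"
      with d q(1) show "c * (norm q + t) \<le> norm (q + of_real t)"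
        unfolding c_def by (intro norm_add_of_real_ge) (auto simp: d_def)
    qed (use c in auto)
    have B_nonneg: "0 \<le> ?B q"
      by simp
    have "deriv (\<lambda>s. boole_sum M s q) (- of_nat n) =
        1 / 4 * q ^ (n - 1) - 1 / 2 * euler_poly n q * Ln q + (\<Sum>k=1..K + 2. b k q)"
      using deriv_boole_sum_odd[OF q_nonzero, of n "K + 2"] assms(2,3)
      unfolding M_def b_def sum_distrib_left[symmetric] by simp
    also have "{1..K + 2} = ({1..N} \<union> {N + 1..K}) \<union> {K + 1, K + 2}"
      using assms(3) by (auto simp: N_def)
    also have "(\<Sum>k\<in>\<dots>. b k q) =
        (\<Sum>k=1..N. b k q) + (\<Sum>k=N + 1..K. b k q) + (b (K + 1) q + b (K + 2) q)"
      using assms(3) by (subst sum.union_disjoint, force, force, force simp: N_def)+ simp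
    also have "1 / 4 * q ^ (n - 1) - 1 / 2 * euler_poly n q * Ln q + \<dots> =
        ?E + (b (K + 1) q + b (K + 2) q)"
    proof -
      have "(\<Sum>k=1..N. b k q) = - 1 / 2 * (\<Sum>k = 1..N. euler_poly (2 * k + 1) 0
                   * (\<Sum>j = 0..2 * k. of_nat (n choose j) * ((-1) ^ j / of_nat (2 * k - j + 1)))
                   * q powi (int n - 2 * int k - 1))"
        unfolding b_le sum_distrib_left ..
      moreover have "(\<Sum>k=N + 1..K. b k q) = (-1) ^ (n + 1) * (fact n / 2) * (\<Sum>k = N + 1..K.
                   euler_poly (2 * k + 1) 0 / (\<Prod>i = 0..n. of_nat (2 * k + 1 - i))
                   * q powi (int n - 2 * int k - 1))"
        unfolding sum_distrib_left by (intro sum.cong refl b_gt) auto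
      ultimately show ?thesis
        by (simp add: N_def)
    qed
    finally have "?D - ?E = deriv (defect_series M) (- of_nat n) + b (K + 1) q + b (K + 2) q"
      using deriv_alt_hurwitz_zeta[of n M] assms(3) by (simp add: M_def)
    also have "norm \<dots> \<le> norm (deriv (defect_series M) (- of_nat n)) + norm (b (K + 1) q) + norm (b (K + 2) q)"
      by (intro norm_triangle_le add_mono norm_triangle_ineq order_refl)
    also have "\<dots> \<le> C * ?B q"
    proof -
      \<comment> \<open>Here M - 2 - n = 2K + 3 - n, which is exactly the required order;
        \<open>K \<ge> n div 2\<close> makes it a genuine natural number.\<close>
      have "(1 / norm q) ^ (M - 2 - n) = ?B q"
      proof -
        have "int n - 2 * int K - 3 = - int (M - 2 - n)"
          using assms(3) by (simp add: M_def)
        then show ?thesis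
          by (simp add: power_int_minus power_one_over inverse_eq_divide)
      qed
      then have "norm (deriv (defect_series M) (- of_nat n)) \<le>
          2 * (defect_const (n + 1) M * (\<Sum>j. 1 / (1 + real j)\<^sup>2)) * ?B q"
        using norm_deriv_defect_series_le[of n M] assms(3) by (simp add: M_def mult_ac)
      \<comment> \<open>For |q| \<ge> 1 a smaller exponent gives a smaller power, and n - 2k - 1
        \<le> n - 2K - 3 once k > K.\<close>
      moreover have "norm (b k q) \<le> norm (b k 1) * ?B q" if "k \<ge> K + 1" for k
      proof -
        have "norm q powi (int n - 2 * int k - 1) \<le> ?B q"
          using that norm_q_ge_1 by (intro power_int_increasing) auto
        then show ?thesis
          by (simp add: b_def norm_mult norm_power_int mult_left_mono)
      qed
      ultimately show ?thesis
        unfolding C_def distrib_right by (intro add_mono) auto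
    qed
    finally show ?thesis
      using B_nonneg by (simp only: norm_of_real abs_of_nonneg)
  qed
  then show ?thesis
    by (intro bigoI[of _ C]) (auto simp: eventually_inf_principal eventually_at_infinity)
qed

end
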